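(* Let $X$ be a finite or countable set and $\varphi$ a coloring on $X$. Suppose that for every $F\subseteq X$ with $|F|\le 4$ there is a finite set $Y$ with $F\subseteq Y\subseteq X$ such that the restriction $\varphi|Y$ is reconstructible (as a coloring on $Y$). Then $\varphi$ is reconstructible.
   Context: A coloring on a set $X$ is a function $\varphi:[X]^2\to\{0,1\}$, where $[X]^2$ is the set of $2$-element subsets of $X$. For $Y\subseteq X$, $\varphi|Y$ is the restriction of $\varphi$ to $[Y]^2$. Let $\mathrm{hom}(\varphi)=\{H\subseteq X:\ |H|>2 \text{ and } \varphi \text{ is constant on } [H]^2\}$, and $1-\varphi$ the complementary coloring. A coloring $\varphi$ on $X$ is reconstructible if for every coloring $\psi$ on $X$ with $\mathrm{hom}(\psi)=\mathrm{hom}(\varphi)$ one has $\psi=\varphi$ or $\psi=1-\varphi$. *)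

theory Defs
  imports "HOL-Library.Ramsey" "HOL-Library.FuncSet" "HOL-Library.Countable_Set"
begin

(* A coloring on X has domain exactly [X]^2: it is an extensional function, so that equality of
   colorings on X is equality of HOL functions. *)
definition coloring_on :: "'a set \<Rightarrow> ('a set \<Rightarrow> nat) \<Rightarrow> bool" where
  "coloring_on X \<phi> \<longleftrightarrow> \<phi> \<in> nsets X 2 \<rightarrow>\<^sub>E {0, 1}"

definition restrict_coloring :: "('a set \<Rightarrow> nat) \<Rightarrow> 'a set \<Rightarrow> 'a set \<Rightarrow> nat" where
  "restrict_coloring \<phi> Y = restrict \<phi> (nsets Y 2)"

definition compl_coloring :: "'a set \<Rightarrow> ('a set \<Rightarrow> nat) \<Rightarrow> 'a set \<Rightarrow> nat" where
  "compl_coloring X \<phi> = (\<lambda>e\<in>nsets X 2. 1 - \<phi> e)"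

(* Infinite homogeneous sets count; they need a separate disjunct as card is 0 on infinite sets. *)
definition hom_sets :: "'a set \<Rightarrow> ('a set \<Rightarrow> nat) \<Rightarrow> 'a set set" where
  "hom_sets X \<phi> =
     {H. H \<subseteq> X \<and> (infinite H \<or> card H > 2) \<and> (\<exists>c. \<forall>e\<in>nsets H 2. \<phi> e = c)}"

definition reconstructible :: "'a set \<Rightarrow> ('a set \<Rightarrow> nat) \<Rightarrow> bool" where
  "reconstructible X \<phi> \<longleftrightarrow> coloring_on X \<phi> \<and>
     (\<forall>\<psi>. coloring_on X \<psi> \<and> hom_sets X \<psi> = hom_sets X \<phi> \<longrightarrow> \<psi> = \<phi> \<or> \<psi> = compl_coloring X \<phi>)"

end

theory Submission
  imports Defs
begin

text \<open>
  A coloring that is neither \<open>\<phi>\<close> nor its complement is witnessed to be so by two edges, which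
  together span at most four points, and this failure is visible in any restriction to a set
  containing these points; restriction also preserves equality of the homogeneous families.
\<close>

text \<open>Homogeneity of \<open>H\<close> only looks at pairs inside \<open>H\<close>; for
  \<open>H \<subseteq> Y\<close> these lie in \<open>Y\<close>, where restricting changes no value.
  Hence the family on \<open>Y\<close> is determined by the family on \<open>X\<close>.\<close>

lemma hom_sets_restrict_coloring:
  assumes "Y \<subseteq> X"
  shows "hom_sets Y (restrict_coloring \<phi> Y) = {H \<in> hom_sets X \<phi>. H \<subseteq> Y}"
proof -
  have "restrict_coloring \<phi> Y e = \<phi> e" if "H \<subseteq> Y" "e \<in> nsets H 2" for H e
    using that nsets_mono[of H Y 2] by (simp add: restrict_coloring_def subset_iff)
  then have "(\<forall>e\<in>nsets H 2. restrict_coloring \<phi> Y e = c) \<longleftrightarrow> (\<forall>e\<in>nsets H 2. \<phi> e = c)"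
    if "H \<subseteq> Y" for H c
    using that by metis
  then show ?thesis
    using assms unfolding hom_sets_def by blast
qed

lemma coloring_on_restrict_coloring:
  assumes "coloring_on X \<phi>" and "Y \<subseteq> X"
  shows "coloring_on Y (restrict_coloring \<phi> Y)"
  using assms(1) nsets_mono[OF assms(2), of 2] unfolding coloring_on_def restrict_coloring_def
  by (metis restrict_PiE_iff PiE_mem subset_iff)

theorem mainTheorem3:
  fixes X :: "'a set" and \<phi> :: "'a set \<Rightarrow> nat"
  assumes "countable X"
    and "coloring_on X \<phi>"
    and "\<And>F. F \<subseteq> X \<Longrightarrow> finite F \<Longrightarrow> card F \<le> 4 \<Longrightarrow>
           \<exists>Y. finite Y \<and> F \<subseteq> Y \<and> Y \<subseteq> X \<and> reconstructible Y (restrict_coloring \<phi> Y)"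
  shows "reconstructible X \<phi>"
  unfolding reconstructible_def
proof (intro conjI allI impI, fact, elim conjE, rule ccontr)
  fix \<psi> assume \<psi>: "coloring_on X \<psi>" and hom: "hom_sets X \<psi> = hom_sets X \<phi>"
    and neither: "\<not> (\<psi> = \<phi> \<or> \<psi> = compl_coloring X \<phi>)"
  \<comment> \<open>Both functions are \<open>undefined\<close> off the pairs of \<open>X\<close>,
    so inequality must show on some pair.\<close>
  have "\<exists>e\<in>nsets X 2. \<psi> e \<noteq> \<phi> e"
    using neither \<psi> assms(2) unfolding coloring_on_def by (metis PiE_ext)
  then obtain e where e: "e \<in> nsets X 2" "\<psi> e \<noteq> \<phi> e" by blast
  \<comment> \<open>Likewise for the complement, which is extensional by construction. As values are
    0 or 1, the colorings agree at such an \<open>f\<close>.\<close>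
  have "\<exists>f\<in>nsets X 2. \<psi> f \<noteq> 1 - \<phi> f"
  proof (rule ccontr)
    assume "\<not> ?thesis"
    then have "\<psi> = compl_coloring X \<phi>"
      using \<psi> unfolding coloring_on_def compl_coloring_def
      by (intro extensionalityI[where A = "nsets X 2"]) (auto simp: PiE_def)
    with neither show False by blast
  qed
  then obtain f where f: "f \<in> nsets X 2" "\<psi> f \<noteq> 1 - \<phi> f" by blast
  have ef_X: "e \<subseteq> X" "finite e" "card e = 2" "f \<subseteq> X" "finite f" "card f = 2"
    using e(1) f(1) unfolding nsets_def by simp_all
  \<comment> \<open>Two pairs may share a point, hence only an upper bound.\<close>
  then have "e \<union> f \<subseteq> X" "finite (e \<union> f)" "card (e \<union> f) \<le> 4"
    using card_Un_le[of e f] by simp_all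
  from assms(3)[OF this] obtain Y where Y: "e \<union> f \<subseteq> Y" "Y \<subseteq> X"
    and rec: "reconstructible Y (restrict_coloring \<phi> Y)"
    by blast
  have ef: "e \<in> nsets Y 2" "f \<in> nsets Y 2"
    using ef_X Y(1) unfolding nsets_def by simp_all
  \<comment> \<open>Both sides select the members contained in \<open>Y\<close> from one and the
    same family on \<open>X\<close>.\<close>
  have "hom_sets Y (restrict_coloring \<psi> Y) = hom_sets Y (restrict_coloring \<phi> Y)"
    using hom by (simp add: hom_sets_restrict_coloring[OF Y(2)])
  then have "restrict_coloring \<psi> Y = restrict_coloring \<phi> Y \<or>
      restrict_coloring \<psi> Y = compl_coloring Y (restrict_coloring \<phi> Y)"
    using rec coloring_on_restrict_coloring[OF \<psi> Y(2)] unfolding reconstructible_def by blast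
  then show False
  proof
    assume "restrict_coloring \<psi> Y = restrict_coloring \<phi> Y"
    \<comment> \<open>Since \<open>e\<close> is a pair of \<open>Y\<close>, evaluating there
      recovers the original values, which differ; \<open>f\<close> settles the other case in the
      same way.\<close>
    from fun_cong[OF this, of e] show False
      using ef e(2) by (simp add: restrict_coloring_def)
  next
    assume "restrict_coloring \<psi> Y = compl_coloring Y (restrict_coloring \<phi> Y)"
    from fun_cong[OF this, of f] show False
      using ef f(2) by (simp add: restrict_coloring_def compl_coloring_def)
  qed
qed

end
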